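(* Let $A\in\mathbb{Z}^{r\times n}$, $\mathbf{b}\in\mathbb{Z}^r$, $M=\begin{pmatrix}\mathrm{id}_n&\mathbf{0}\\ A&-\mathbf{b}\end{pmatrix}$, and let $M_k\langle I;J\rangle$ be a (well-defined) matrix obtained from $M$ by $k$ successive pivot operations with row index set $I\subseteq[r]$ and column index set $J\subseteq[n]$, $|I|=|J|=k$. Let $i\in[r]\setminus I$, $j\in[n]\setminus J$, and suppose the pivot item $p_{k+1}$, i.e. the $(n+i,j)$ entry of $M_k\langle I;J\rangle$, is nonzero. Then $$\mathop{\mathrm{CT}}_{\lambda_i,j}[M_k\langle I;J\rangle]=\mathrm{sgn}(p_{k+1})\,\mathcal{Z}_{y_j}\big[M_k\langle I;J\rangle\leftarrow(i,j)\big].$$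
   Context: Variables: $\mathbf{y}=(y_1,\dots,y_n)$, $\Lambda=(\lambda_1,\dots,\lambda_r)$. "Fractional" means that rational exponents are allowed. $[n]=\{1,\dots,n\}$. Matrix forms. For an $(n+r)\times(n+1)$ matrix $O$ with nonzero $(n+i,j)$ entry ($i\in[r]$, $j\in[n]$), $O\leftarrow(i,j)$ is obtained from $O$ by adding $-O_{n+i,s}/O_{n+i,j}$ times column $j$ to column $s$ for all $s\neq j$; row $n+i$ and column $j$ are ignored afterwards. For $I=\{i_1,\dots,i_k\}$, $J=\{j_1,\dots,j_k\}$, $M_k\langle I;J\rangle=M\leftarrow(i_1,j_1)\leftarrow\cdots\leftarrow(i_k,j_k)$ (assuming all pivots are nonzero), with rows $n+I$ and columns $J$ ignored. With columns $\gamma_1,\dots,\gamma_{n+1}$ of $M_k\langle I;J\rangle$ set $[M_k\langle I;J\rangle]=(\mathbf{y},\Lambda)^{\gamma_{n+1}}\big/\prod_{j\in[n]\setminus J}\big(1-(\mathbf{y},\Lambda)^{\gamma_j}\big)$, entries in ignored rows being omitted. In $[M_k\langle I;J\rangle\leftarrow(i,j)]$ the ignored rows are $n+(I\cup\{i\})$ and the ignored columns $J\cup\{j\}$. $\mathcal{Z}_{y_j}$ acts on fractional series by keeping exactly the terms in which the exponent of $y_j$ is an integer; applied to a fractional rational function with denominator a product of factors $1-(\text{monomial})$ the result is a rational function independent of the chosen series expansion. The operator $\mathrm{CT}_{\lambda,j}$. Let $E=L(\lambda)/\prod_{\ell}(1-u_\ell\lambda^{b_\ell})$ be a fractional rational function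 with pairwise coprime denominator factors, $u_\ell$ free of $\lambda$, $b_\ell\in\mathbb{Q}$. If $b_j\neq0$ and the variable $y_j$ appears only in $u_j=y_ju_j'$ (with $u_j'$ free of $y_j$), then $$\mathrm{CT}_{\lambda,j}E:=\mathrm{sgn}(b_j)\,\mathcal{Z}_{y_j}\Big(\big(E\cdot(1-u_j\lambda^{b_j})\big)\big|_{\lambda=(y_ju_j')^{-1/b_j}}\Big).$$ *)

theory Defs
  imports
    "HOL-Library.Poly_Mapping"
    "HOL-Computational_Algebra.Fraction_Field"
    "Jordan_Normal_Form.Matrix"
begin

section \<open>Fractional rational functions\<close>

text \<open>
  Variables are indexed by natural numbers. For fixed \<open>n\<close> and \<open>r\<close>, the variable with index
  \<open>j < n\<close> is $y_{j+1}$ and the one with index \<open>n + i\<close>, \<open>i < r\<close>, is $\lambda_{i+1}$, so that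
  row \<open>a\<close> of an \<open>(n + r) \<times> (n + 1)\<close> matrix holds exponents of the variable \<open>a\<close>.

  Fractional Laurent polynomials form the group algebra of the additive group of finitely
  supported rational exponent vectors.
\<close>

type_synonym expo = "nat \<Rightarrow>\<^sub>0 rat"
type_synonym 'k fpoly = "expo \<Rightarrow>\<^sub>0 'k"
type_synonym 'k frat = "'k fpoly fract"

definition fpoly_frat :: "'k::field_char_0 fpoly \<Rightarrow> 'k frat" where
  "fpoly_frat p = Fraction_Field.Fract p 1"

definition fmonom :: "expo \<Rightarrow> 'k::field_char_0 fpoly" where
  "fmonom e = Poly_Mapping.single e 1"

definition fconst :: "'k::field_char_0 \<Rightarrow> 'k frat" where
  "fconst c = fpoly_frat (Poly_Mapping.single 0 c)"

definition scale_expo :: "rat \<Rightarrow> expo \<Rightarrow> expo" where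
  "scale_expo c e = Poly_Mapping.map ((*) c) e"


section \<open>Series expansions and the operator Z\<close>

text \<open>
  A fractional series is a function on exponent vectors whose support is well-ordered by some
  translation-invariant total order \<open>R\<close> (a Malcev-Neumann series). For a fixed \<open>R\<close> these series
  form a field, so the expansion of a fraction \<open>p / q\<close> is the unique such series \<open>s\<close> with
  \<open>q * s = p\<close>; the product needs only finite sums because \<open>q\<close> has finite support.
\<close>

definition expo_order :: "expo rel \<Rightarrow> bool" where
  "expo_order R \<longleftrightarrow>
     linear_order_on UNIV R \<and> (\<forall>a b c. (a, b) \<in> R \<longrightarrow> (a + c, b + c) \<in> R)"

definition fseries :: "expo rel \<Rightarrow> (expo \<Rightarrow> 'k::field_char_0) \<Rightarrow> bool" where
  "fseries R s \<longleftrightarrow> well_order_on {e. s e \<noteq> 0} (Restr R {e. s e \<noteq> 0})"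

definition fpoly_times_series ::
    "'k::field_char_0 fpoly \<Rightarrow> (expo \<Rightarrow> 'k) \<Rightarrow> expo \<Rightarrow> 'k" where
  "fpoly_times_series q s e =
     (\<Sum>a\<in>Poly_Mapping.keys q. Poly_Mapping.lookup q a * s (e - a))"

definition expands :: "expo rel \<Rightarrow> 'k::field_char_0 frat \<Rightarrow> (expo \<Rightarrow> 'k) \<Rightarrow> bool" where
  "expands R E s \<longleftrightarrow> fseries R s \<and>
     (\<exists>p q. q \<noteq> 0 \<and> E = Fraction_Field.Fract p q \<and> fpoly_times_series q s = Poly_Mapping.lookup p)"

definition Z_series :: "nat \<Rightarrow> (expo \<Rightarrow> 'k::field_char_0) \<Rightarrow> expo \<Rightarrow> 'k" where
  "Z_series y s = (\<lambda>e. if Poly_Mapping.lookup e y \<in> \<int> then s e else 0)"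

text \<open>
  The value of \<open>Z\<close> on a fractional rational function is the rational function representing the
  filtered series for every choice of the expansion.
\<close>

definition Z_op :: "nat \<Rightarrow> 'k::field_char_0 frat \<Rightarrow> 'k frat" where
  "Z_op y E = (THE F. \<forall>R s. expo_order R \<longrightarrow> expands R E s \<longrightarrow> expands R F (Z_series y s))"


section \<open>Substitution of a monomial for a variable\<close>

definition subst_expo :: "nat \<Rightarrow> expo \<Rightarrow> expo \<Rightarrow> expo" where
  "subst_expo v \<mu> e =
     e - Poly_Mapping.single v (Poly_Mapping.lookup e v) + scale_expo (Poly_Mapping.lookup e v) \<mu>"

definition subst_fpoly :: "nat \<Rightarrow> expo \<Rightarrow> 'k::field_char_0 fpoly \<Rightarrow> 'k fpoly" where
  "subst_fpoly v \<mu> p =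
     (\<Sum>e\<in>Poly_Mapping.keys p. Poly_Mapping.single (subst_expo v \<mu> e) (Poly_Mapping.lookup p e))"

text \<open>
  As \<open>subst_fpoly v \<mu>\<close> is a ring homomorphism, the value below does not depend on the
  representing fraction; it is unspecified if every denominator vanishes under the substitution.
\<close>

definition subst_frat :: "nat \<Rightarrow> expo \<Rightarrow> 'k::field_char_0 frat \<Rightarrow> 'k frat" where
  "subst_frat v \<mu> E =
     (THE F. \<exists>p q. E = Fraction_Field.Fract p q \<and> subst_fpoly v \<mu> q \<noteq> 0 \<and>
                   F = Fraction_Field.Fract (subst_fpoly v \<mu> p) (subst_fpoly v \<mu> q))"


section \<open>The operator CT\<close>

text \<open>
  \<open>ct_factor v u b\<close> is the denominator factor $1 - u \lambda^b$ with \<open>v\<close> the index of $\lambda$ and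
  \<open>u\<close> given by its exponent vector. The \<open>u\<close> are monomials with coefficient 1, so that rational
  powers of them make sense.
\<close>

definition ct_factor :: "nat \<Rightarrow> expo \<Rightarrow> rat \<Rightarrow> 'k::field_char_0 fpoly" where
  "ct_factor v u b = 1 - fmonom (u + Poly_Mapping.single v b)"

text \<open>The type class of \<^const>\<open>coprime\<close> does not cover group algebras.\<close>

definition coprime_fpoly :: "'k::field_char_0 fpoly \<Rightarrow> 'k fpoly \<Rightarrow> bool" where
  "coprime_fpoly p q \<longleftrightarrow> (\<forall>d. d dvd p \<longrightarrow> d dvd q \<longrightarrow> d dvd 1)"

definition ct_form ::
    "nat \<Rightarrow> nat \<Rightarrow> 'k::field_char_0 frat \<Rightarrow>
     nat set \<Rightarrow> 'k fpoly \<Rightarrow> (nat \<Rightarrow> expo) \<Rightarrow> (nat \<Rightarrow> rat) \<Rightarrow> nat \<Rightarrow> bool" where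
  "ct_form v y E S L u b j \<longleftrightarrow>
     finite S \<and> j \<in> S \<and>
     E = fpoly_frat L / (\<Prod>l\<in>S. fpoly_frat (ct_factor v (u l) (b l))) \<and>
     (\<forall>l\<in>S. (ct_factor v (u l) (b l) :: 'k fpoly) \<noteq> 0) \<and>
     (\<forall>l\<in>S. \<forall>m\<in>S. l \<noteq> m \<longrightarrow>
        coprime_fpoly (ct_factor v (u l) (b l) :: 'k fpoly) (ct_factor v (u m) (b m))) \<and>
     (\<forall>l\<in>S. v \<notin> Poly_Mapping.keys (u l)) \<and>
     b j \<noteq> 0 \<and>
     Poly_Mapping.lookup (u j) y = 1 \<and>
     (\<forall>l\<in>S - {j}. y \<notin> Poly_Mapping.keys (u l)) \<and>
     (\<forall>e\<in>Poly_Mapping.keys L. y \<notin> Poly_Mapping.keys e)"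

text \<open>
  \<open>ct_op v y E\<close> is $\mathrm{CT}_{\lambda,j} E$ with \<open>v\<close> the index of $\lambda$ and \<open>y\<close> that of $y_j$.
  The factor $1 - u_j \lambda^{b_j}$ with $u_j = y_j u_j'$ is the only one containing $y_j$, hence
  for \<open>E \<noteq> 0\<close> it is determined by \<open>E\<close>.
\<close>

definition ct_op :: "nat \<Rightarrow> nat \<Rightarrow> 'k::field_char_0 frat \<Rightarrow> 'k frat" where
  "ct_op v y E =
     (THE F. \<exists>S L u b j. ct_form v y E S L u b j \<and>
        F = fconst (of_rat (sgn (b j))) *
            Z_op y (subst_frat v (scale_expo (- (1 / b j)) (u j))
                     (E * fpoly_frat (ct_factor v (u j) (b j)))))"


section \<open>Matrix forms\<close>

definition init_mat :: "nat \<Rightarrow> nat \<Rightarrow> int mat \<Rightarrow> int vec \<Rightarrow> rat mat" where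
  "init_mat n r A b =
     four_block_mat (1\<^sub>m n) (0\<^sub>m n 1)
       (map_mat of_int A) (mat r 1 (\<lambda>(i, _). - of_int (b $ i)))"

definition pivot_op :: "nat \<Rightarrow> rat mat \<Rightarrow> nat \<Rightarrow> nat \<Rightarrow> rat mat" where
  "pivot_op n Q i j =
     mat (dim_row Q) (dim_col Q)
       (\<lambda>(a, s). if s = j then Q $$ (a, j)
                 else Q $$ (a, s) - Q $$ (n + i, s) / Q $$ (n + i, j) * Q $$ (a, j))"

text \<open>
  \<open>pivoted n r M k I J Q\<close>: \<open>Q\<close> arises from \<open>M\<close> by \<open>k\<close> successive pivots, all nonzero, with row
  indices \<open>I\<close> and column indices \<open>J\<close>. Ignored rows and columns are kept in the matrix; they are
  neither used for further pivots nor read by \<open>bracket\<close>.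
\<close>

inductive pivoted ::
    "nat \<Rightarrow> nat \<Rightarrow> rat mat \<Rightarrow> nat \<Rightarrow> nat set \<Rightarrow> nat set \<Rightarrow> rat mat \<Rightarrow> bool"
  for n r :: nat and M :: "rat mat"
where
  start: "pivoted n r M 0 {} {} M"
| step: "pivoted n r M k I J Q \<Longrightarrow> i \<in> {..<r} - I \<Longrightarrow> j \<in> {..<n} - J \<Longrightarrow> Q $$ (n + i, j) \<noteq> 0
    \<Longrightarrow> pivoted n r M (Suc k) (insert i I) (insert j J) (pivot_op n Q i j)"

definition col_expo :: "nat \<Rightarrow> nat set \<Rightarrow> rat mat \<Rightarrow> nat \<Rightarrow> expo" where
  "col_expo n I Q s =
     (\<Sum>a\<in>{..<dim_row Q} - (\<lambda>i. n + i) ` I. Poly_Mapping.single a (Q $$ (a, s)))"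

definition bracket :: "nat \<Rightarrow> nat set \<Rightarrow> nat set \<Rightarrow> rat mat \<Rightarrow> 'k::field_char_0 frat" where
  "bracket n I J Q =
     fpoly_frat (fmonom (col_expo n I Q n)) /
       (\<Prod>s\<in>{..<n} - J. 1 - fpoly_frat (fmonom (col_expo n I Q s)))"

end

theory Submission
  imports Defs
begin

text \<open>
  The matrix keeps the shape \<open>Q $$ (a, s) = \<delta>\<^sub>a\<^sub>s\<close> in all rows \<open>a < n\<close>, \<open>a \<notin> J\<close>. So for
  \<open>s \<notin> J\<close> the column \<open>\<gamma>\<^sub>s\<close> is the only one containing the variable \<open>y\<^sub>s\<close>, which makes the
  denominator factors of the bracket nonzero and pairwise coprime, and the bracket an
  admissible argument of the operator CT. Comparing the parts of degree 0 and 1 in \<open>y\<^sub>j\<close>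
  shows that the distinguished factor is determined by the fraction, hence that CT is well
  defined. Substituting \<open>\<lambda> = u\<^sub>j\<^bsup>-1/b\<^sub>j\<^esup>\<close> acts on exponent vectors as the column operation
  of the pivot step.
\<close>

section \<open>Exponent vectors and the group algebra\<close>

lemma lookup_scale_expo [simp]:
  "Poly_Mapping.lookup (scale_expo c e) a = c * Poly_Mapping.lookup e a"
  by (simp add: scale_expo_def Poly_Mapping.map.rep_eq when_def)

lemma lookup_subst_expo:
  "Poly_Mapping.lookup (subst_expo v \<mu> e) a =
     (if a = v then 0 else Poly_Mapping.lookup e a) + Poly_Mapping.lookup e v * Poly_Mapping.lookup \<mu> a"
  by (simp add: subst_expo_def lookup_add lookup_minus lookup_single when_def)

lemma subst_expo_add: "subst_expo v \<mu> (d + e) = subst_expo v \<mu> d + subst_expo v \<mu> e"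
  by (rule poly_mapping_eqI) (simp add: lookup_subst_expo lookup_add algebra_simps)

lemma subst_expo_zero [simp]: "subst_expo v \<mu> 0 = 0"
  by (rule poly_mapping_eqI) (simp add: lookup_subst_expo)

lemma fmonom_zero [simp]: "fmonom 0 = 1"
  by (simp add: fmonom_def)

lemma fmonom_nonzero [simp]: "fmonom e \<noteq> 0"
  by (metis fmonom_def keys_single keys_zero insert_not_empty zero_neq_one)

lemma fmonom_inject [simp]:
  "(fmonom d :: 'k::field_char_0 fpoly) = fmonom e \<longleftrightarrow> d = e"
  by (metis fmonom_def keys_single singleton_inject zero_neq_one)

lemma fmonom_eq_1_iff [simp]: "(fmonom e :: 'k::field_char_0 fpoly) = 1 \<longleftrightarrow> e = 0"
  by (metis fmonom_inject fmonom_zero)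

lemma keys_fmonom [simp]: "Poly_Mapping.keys (fmonom e :: 'k::field_char_0 fpoly) = {e}"
  by (simp add: fmonom_def)

lemma keys_minus_subset:
  fixes p q :: "'a \<Rightarrow>\<^sub>0 'b::ab_group_add"
  shows "Poly_Mapping.keys (p - q) \<subseteq> Poly_Mapping.keys p \<union> Poly_Mapping.keys q"
  by (auto simp: in_keys_iff lookup_minus)

lemma sum_single_keys:
  "(\<Sum>e\<in>Poly_Mapping.keys p. Poly_Mapping.single e (Poly_Mapping.lookup p e)) = p"
proof (rule poly_mapping_eqI)
  fix k
  show "Poly_Mapping.lookup (\<Sum>e\<in>Poly_Mapping.keys p. Poly_Mapping.single e (Poly_Mapping.lookup p e)) k
      = Poly_Mapping.lookup p k"
    by (cases "k \<in> Poly_Mapping.keys p")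
      (auto simp: lookup_sum lookup_single when_def in_keys_iff)
qed

lemma keys_multE:
  assumes "e \<in> Poly_Mapping.keys (p * q)"
  obtains a c where "e = a + c" "a \<in> Poly_Mapping.keys p" "c \<in> Poly_Mapping.keys q"
  using assms keys_mult[of p q] by auto

section \<open>Coprimality\<close>

text \<open>Grade the algebra by \<phi>. The parts of \<open>p\<close> and \<open>q\<close> of
  maximal degree have a nonzero product because the group algebra is an integral domain, and all
  remaining products have smaller degree, so nothing cancels it.\<close>

lemma top_key_mult:
  fixes p q :: "'k::field_char_0 fpoly" and \<phi> :: "expo \<Rightarrow> rat"
  assumes add: "\<And>d e. \<phi> (d + e) = \<phi> d + \<phi> e" and "p \<noteq> 0" "q \<noteq> 0"
  obtains k where "k \<in> Poly_Mapping.keys (p * q)"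
    "\<phi> k = Max (\<phi> ` Poly_Mapping.keys p) + Max (\<phi> ` Poly_Mapping.keys q)"
proof -
  define top :: "'k fpoly \<Rightarrow> 'k fpoly" where
    "top f = Poly_Mapping.mapp (\<lambda>e c. if \<phi> e = Max (\<phi> ` Poly_Mapping.keys f) then c else 0) f" for f
  have top: "Poly_Mapping.lookup (top f) e =
      (if \<phi> e = Max (\<phi> ` Poly_Mapping.keys f) then Poly_Mapping.lookup f e else 0)" for f e
    by (auto simp: top_def lookup_mapp when_def in_keys_iff)
  have top_keys: "\<phi> e = Max (\<phi> ` Poly_Mapping.keys f)" if "e \<in> Poly_Mapping.keys (top f)" for f e
    using that by (auto simp: in_keys_iff top split: if_splits)
  have rest_keys: "\<phi> e < Max (\<phi> ` Poly_Mapping.keys f)" if "e \<in> Poly_Mapping.keys (f - top f)" for f e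
  proof -
    have "e \<in> Poly_Mapping.keys f" "\<phi> e \<noteq> Max (\<phi> ` Poly_Mapping.keys f)"
      using that by (auto simp: in_keys_iff lookup_minus top split: if_splits)
    then show ?thesis by (simp add: order_less_le)
  qed
  have top_nz: "top f \<noteq> 0" if "f \<noteq> 0" for f
  proof -
    have "Poly_Mapping.keys f \<noteq> {}"
      using that by (metis poly_mapping_eqI in_keys_iff empty_iff lookup_zero)
    then have "Max (\<phi> ` Poly_Mapping.keys f) \<in> \<phi> ` Poly_Mapping.keys f" by simp
    then obtain e where "e \<in> Poly_Mapping.keys f" "Max (\<phi> ` Poly_Mapping.keys f) = \<phi> e" by auto
    then have "Poly_Mapping.lookup (top f) e \<noteq> 0" by (simp add: top in_keys_iff)
    then show ?thesis by auto
  qed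
  let ?m = "Max (\<phi> ` Poly_Mapping.keys p) + Max (\<phi> ` Poly_Mapping.keys q)"
  have "top p * top q \<noteq> 0" using top_nz assms(2,3) by simp
  then obtain k where k: "k \<in> Poly_Mapping.keys (top p * top q)"
    by (metis poly_mapping_eqI in_keys_iff lookup_zero)
  then have \<phi>k: "\<phi> k = ?m"
    by (rule keys_multE) (simp add: add top_keys)
  \<comment> \<open>Weak bounds for both factors and a strict one for either of them cover both
    error terms of the decomposition below.\<close>
  have low: "\<phi> e < ?m" if e: "e \<in> Poly_Mapping.keys (f * g)"
    and "\<And>d. d \<in> Poly_Mapping.keys f \<Longrightarrow> \<phi> d \<le> Max (\<phi> ` Poly_Mapping.keys p)"
    and "\<And>d. d \<in> Poly_Mapping.keys g \<Longrightarrow> \<phi> d \<le> Max (\<phi> ` Poly_Mapping.keys q)"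
    and "(\<forall>d\<in>Poly_Mapping.keys f. \<phi> d < Max (\<phi> ` Poly_Mapping.keys p)) \<or>
      (\<forall>d\<in>Poly_Mapping.keys g. \<phi> d < Max (\<phi> ` Poly_Mapping.keys q))" for e and f g :: "'k fpoly"
  proof -
    obtain a c where ac: "e = a + c" "a \<in> Poly_Mapping.keys f" "c \<in> Poly_Mapping.keys g"
      using e by (rule keys_multE)
    then have "\<phi> e = \<phi> a + \<phi> c" by (simp add: add)
    then show ?thesis
      using that(2)[OF ac(2)] that(3)[OF ac(3)] that(4) ac(2,3)
      by (auto intro: add_less_le_mono add_le_less_mono)
  qed
  have "k \<notin> Poly_Mapping.keys ((p - top p) * q)"
    using low[of k "p - top p" q] rest_keys[of _ p] \<phi>k by (force intro: less_imp_le)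
  moreover have "k \<notin> Poly_Mapping.keys (top p * (q - top q))"
    using low[of k "top p" "q - top q"] rest_keys[of _ q] top_keys[of _ p] \<phi>k
    by (force intro: less_imp_le)
  moreover have "p * q = top p * top q + top p * (q - top q) + (p - top p) * q"
    by (simp add: algebra_simps)
  ultimately have "k \<in> Poly_Mapping.keys (p * q)"
    using k by (simp add: in_keys_iff lookup_add)
  with \<phi>k show thesis using that by blast
qed

text \<open>Write \<open>p = d * g\<close> and fix one key of \<open>g\<close>. By
  \<open>top_key_mult\<close> for \<phi> and for its negative, the degrees of this key and of any
  key of \<open>d\<close> sum to at most 0 and to at least 0.\<close>

lemma divisor_keys_constant:
  fixes d p :: "'k::field_char_0 fpoly" and \<phi> :: "expo \<Rightarrow> rat"
  assumes add: "\<And>d e. \<phi> (d + e) = \<phi> d + \<phi> e" and "d dvd p" "p \<noteq> 0"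
    and zero: "\<And>e. e \<in> Poly_Mapping.keys p \<Longrightarrow> \<phi> e = 0"
    and x: "x \<in> Poly_Mapping.keys d" and y: "y \<in> Poly_Mapping.keys d"
  shows "\<phi> x = \<phi> y"
proof -
  obtain g where p: "p = d * g" using \<open>d dvd p\<close> by (rule dvdE)
  with \<open>p \<noteq> 0\<close> have nz: "d \<noteq> 0" "g \<noteq> 0" by auto
  then obtain z where z: "z \<in> Poly_Mapping.keys g"
    by (metis poly_mapping_eqI in_keys_iff lookup_zero)
  have max: "\<psi> w + \<psi> z \<le> 0"
    if w: "w \<in> Poly_Mapping.keys d" and z: "z \<in> Poly_Mapping.keys g"
      and ad: "\<And>d e. \<psi> (d + e) = \<psi> d + \<psi> e"
      and "\<And>e. e \<in> Poly_Mapping.keys p \<Longrightarrow> \<psi> e = 0" for \<psi> :: "expo \<Rightarrow> rat" and w z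
  proof -
    obtain k where "k \<in> Poly_Mapping.keys p"
      "\<psi> k = Max (\<psi> ` Poly_Mapping.keys d) + Max (\<psi> ` Poly_Mapping.keys g)"
      using top_key_mult[where \<phi> = \<psi>, OF ad nz] p by metis
    moreover have "\<psi> w \<le> Max (\<psi> ` Poly_Mapping.keys d)" "\<psi> z \<le> Max (\<psi> ` Poly_Mapping.keys g)"
      using w z by simp_all
    ultimately show ?thesis using that(4) by fastforce
  qed
  have "\<phi> w + \<phi> z = 0" if "w \<in> Poly_Mapping.keys d" for w
    using max[OF that z, of \<phi>] max[OF that z, of "\<lambda>e. - \<phi> e"] add zero by fastforce
  from this[OF x] this[OF y] show ?thesis by simp
qed

lemma keys_fmonom_binomial:
  "Poly_Mapping.keys (1 - fmonom e :: 'k::field_char_0 fpoly) \<subseteq> {0, e}"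
  using keys_minus_subset[of "1 :: 'k fpoly" "fmonom e"] by auto

text \<open>
  Every linear functional that kills \<open>\<alpha>\<close> or \<open>\<beta>\<close> is constant on the keys of a common divisor,
  so a common divisor is a monomial.
\<close>

lemma coprime_fmonom_binomial:
  assumes "Poly_Mapping.lookup \<alpha> s = 1" "Poly_Mapping.lookup \<alpha> t = 0"
    and "Poly_Mapping.lookup \<beta> t = 1" "Poly_Mapping.lookup \<beta> s = 0"
  shows "coprime_fpoly (1 - fmonom \<alpha> :: 'k::field_char_0 fpoly) (1 - fmonom \<beta>)"
  unfolding coprime_fpoly_def
proof (intro allI impI)
  fix d :: "'k fpoly"
  assume d: "d dvd 1 - fmonom \<alpha>" "d dvd 1 - fmonom \<beta>"
  have nz: "(1 - fmonom \<alpha> :: 'k fpoly) \<noteq> 0" "(1 - fmonom \<beta> :: 'k fpoly) \<noteq> 0"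
    using assms by auto
  \<comment> \<open>The functional taking e to e_a - \<gamma>_a e_u vanishes at 0, and at \<gamma>
    because \<gamma>_u = 1.\<close>
  have killed: "Poly_Mapping.lookup x a - c a * Poly_Mapping.lookup x u
        = Poly_Mapping.lookup y a - c a * Poly_Mapping.lookup y u"
    if "d dvd 1 - fmonom \<gamma>" "(1 - fmonom \<gamma> :: 'k fpoly) \<noteq> 0" "c = Poly_Mapping.lookup \<gamma>" "c u = 1"
      "x \<in> Poly_Mapping.keys d" "y \<in> Poly_Mapping.keys d" for \<gamma> c u x y a
  proof (rule divisor_keys_constant[OF _ that(1,2) _ that(5,6)])
    fix e
    assume "e \<in> Poly_Mapping.keys (1 - fmonom \<gamma> :: 'k fpoly)"
    then have "e = 0 \<or> e = \<gamma>" using keys_fmonom_binomial by blast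
    then show "Poly_Mapping.lookup e a - c a * Poly_Mapping.lookup e u = 0"
      using that(3,4) by auto
  qed (simp add: lookup_add algebra_simps)
  have unique: "x = y" if xy: "x \<in> Poly_Mapping.keys d" "y \<in> Poly_Mapping.keys d" for x y
  proof (rule poly_mapping_eqI)
    fix a
    note A = killed[OF d(1) nz(1) refl assms(1) xy]
    note B = killed[OF d(2) nz(2) refl assms(3) xy]
    \<comment> \<open>As \<beta> is 0 at \<open>s\<close>, the functional for \<beta> is just
      coordinate \<open>s\<close> there. The functionals for \<alpha>, which subtract multiples of
      coordinate \<open>s\<close>, then give all coordinates.\<close>
    have "Poly_Mapping.lookup x s = Poly_Mapping.lookup y s"
      using B[of s] assms by simp
    then show "Poly_Mapping.lookup x a = Poly_Mapping.lookup y a"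
      using A[of a] by simp
  qed
  have "d \<noteq> 0" using d nz by auto
  then obtain x where x: "x \<in> Poly_Mapping.keys d"
    by (metis poly_mapping_eqI in_keys_iff lookup_zero)
  with unique have "Poly_Mapping.keys d = {x}" by blast
  then have "d = Poly_Mapping.single x (Poly_Mapping.lookup d x)"
    using sum_single_keys[of d] by simp
  moreover have "Poly_Mapping.lookup d x \<noteq> 0" using x by (simp add: in_keys_iff)
  \<comment> \<open>A single nonzero term is a unit: exponents form a group and coefficients a
    field.\<close>
  ultimately have "d * Poly_Mapping.single (- x) (1 / Poly_Mapping.lookup d x) = 1"
    by (metis mult_single add.right_inverse nonzero_eq_divide_eq mult.commute single_one)
  then show "d dvd 1" by (metis dvdI)
qed

section \<open>Substitution\<close>

text \<open>The supports of \<open>p\<close>, \<open>q\<close> and \<open>p + q\<close> differ; a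
  common index set makes additivity a termwise matter.\<close>

lemma subst_fpoly_superset:
  assumes "finite T" "Poly_Mapping.keys p \<subseteq> T"
  shows "subst_fpoly v \<mu> p =
    (\<Sum>e\<in>T. Poly_Mapping.single (subst_expo v \<mu> e) (Poly_Mapping.lookup p e))"
  unfolding subst_fpoly_def
  by (rule sum.mono_neutral_left) (use assms in \<open>auto simp: in_keys_iff\<close>)

lemma subst_fpoly_zero [simp]: "subst_fpoly v \<mu> 0 = 0"
  by (simp add: subst_fpoly_def)

lemma subst_fpoly_single [simp]:
  "subst_fpoly v \<mu> (Poly_Mapping.single e c) = Poly_Mapping.single (subst_expo v \<mu> e) c"
  by (subst subst_fpoly_superset[of "{e}"]) auto

lemma subst_fpoly_add: "subst_fpoly v \<mu> (p + q) = subst_fpoly v \<mu> p + subst_fpoly v \<mu> q"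
proof -
  let ?T = "Poly_Mapping.keys p \<union> Poly_Mapping.keys q"
  have "Poly_Mapping.keys (p + q) \<subseteq> ?T" by (rule keys_add)
  then show ?thesis
    by (simp add: subst_fpoly_superset[of ?T] lookup_add single_add sum.distrib)
qed

lemma subst_fpoly_minus: "subst_fpoly v \<mu> (p - q) = subst_fpoly v \<mu> p - subst_fpoly v \<mu> q"
  by (metis subst_fpoly_add add_diff_cancel_right' diff_add_cancel)

lemma subst_fpoly_sum: "subst_fpoly v \<mu> (\<Sum>x\<in>X. f x) = (\<Sum>x\<in>X. subst_fpoly v \<mu> (f x))"
  by (induction X rule: infinite_finite_induct) (simp_all add: subst_fpoly_add)

text \<open>On products of single terms this is the additivity of \<open>subst_expo\<close>;
  expanding both factors into terms reduces to that case.\<close>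

lemma subst_fpoly_mult: "subst_fpoly v \<mu> (p * q) = subst_fpoly v \<mu> p * subst_fpoly v \<mu> q"
proof -
  let ?s = "\<lambda>p e. Poly_Mapping.single e (Poly_Mapping.lookup p e)"
  have "p * q = (\<Sum>d\<in>Poly_Mapping.keys p. \<Sum>e\<in>Poly_Mapping.keys q. ?s p d * ?s q e)"
    by (simp only: sum_product[symmetric] sum_single_keys)
  then show ?thesis
    by (simp add: subst_fpoly_sum mult_single subst_expo_add)
      (simp add: subst_fpoly_def sum_product mult_single)
qed

lemma subst_fpoly_fmonom [simp]: "subst_fpoly v \<mu> (fmonom e) = fmonom (subst_expo v \<mu> e)"
  by (simp add: fmonom_def)

lemma subst_fpoly_one [simp]: "subst_fpoly v \<mu> 1 = 1"
  using subst_fpoly_fmonom[of v \<mu> 0] by simp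

lemma subst_fpoly_prod: "subst_fpoly v \<mu> (\<Prod>x\<in>X. f x) = (\<Prod>x\<in>X. subst_fpoly v \<mu> (f x))"
  by (induction X rule: infinite_finite_induct) (simp_all add: subst_fpoly_mult)

text \<open>Equality of two fractions is a cross-multiplied identity, which the ring homomorphism
  preserves; the definite description is therefore resolved by any representation whose denominator
  survives.\<close>

lemma subst_frat_Fract:
  assumes "subst_fpoly v \<mu> q \<noteq> 0"
  shows "subst_frat v \<mu> (Fraction_Field.Fract p q) =
    Fraction_Field.Fract (subst_fpoly v \<mu> p) (subst_fpoly v \<mu> q)"
  unfolding subst_frat_def
proof (rule the_equality)
  fix F
  assume "\<exists>p' q'. Fraction_Field.Fract p q = Fraction_Field.Fract p' q' \<and> subst_fpoly v \<mu> q' \<noteq> 0 \<and>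
    F = Fraction_Field.Fract (subst_fpoly v \<mu> p') (subst_fpoly v \<mu> q')"
  then obtain p' q' where eq: "Fraction_Field.Fract p q = Fraction_Field.Fract p' q'"
    and q': "subst_fpoly v \<mu> q' \<noteq> 0"
    and F: "F = Fraction_Field.Fract (subst_fpoly v \<mu> p') (subst_fpoly v \<mu> q')"
    by blast
  \<comment> \<open>Since 0 is mapped to 0, both original denominators are nonzero, as
    cross-multiplying requires.\<close>
  have "q \<noteq> 0" "q' \<noteq> 0" using assms q' by auto
  with eq have "p * q' = p' * q" by (simp add: eq_fract)
  then have "subst_fpoly v \<mu> p * subst_fpoly v \<mu> q' = subst_fpoly v \<mu> p' * subst_fpoly v \<mu> q"
    by (metis subst_fpoly_mult)
  then show "F = Fraction_Field.Fract (subst_fpoly v \<mu> p) (subst_fpoly v \<mu> q)"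
    using assms q' by (simp add: F eq_fract)
qed (use assms in blast)

section \<open>The operator CT\<close>

lemma fpoly_frat_one [simp]: "fpoly_frat 1 = 1"
  by (simp add: fpoly_frat_def One_fract_def)

lemma fpoly_frat_mult: "fpoly_frat (p * q) = fpoly_frat p * fpoly_frat q"
  by (simp add: fpoly_frat_def)

lemma fpoly_frat_minus: "fpoly_frat (p - q) = fpoly_frat p - fpoly_frat q"
  by (simp add: fpoly_frat_def)

lemma fpoly_frat_prod: "fpoly_frat (\<Prod>x\<in>X. f x) = (\<Prod>x\<in>X. fpoly_frat (f x))"
  by (induction X rule: infinite_finite_induct) (simp_all add: fpoly_frat_mult)

lemma fpoly_frat_eq_0_iff [simp]: "fpoly_frat p = 0 \<longleftrightarrow> p = 0"
  by (simp add: fpoly_frat_def Zero_fract_def eq_fract)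

lemma fpoly_frat_divide: "fpoly_frat p / fpoly_frat q = Fraction_Field.Fract p q"
  by (simp add: fpoly_frat_def)

text \<open>The subring of degree 0 in the grading by the exponent of \<open>y\<close>.\<close>

definition y_free :: "nat \<Rightarrow> 'k::field_char_0 fpoly \<Rightarrow> bool" where
  "y_free y p \<longleftrightarrow> (\<forall>e\<in>Poly_Mapping.keys p. Poly_Mapping.lookup e y = 0)"

lemma y_free_mult:
  assumes "y_free y p" "y_free y q"
  shows "y_free y (p * q)"
  unfolding y_free_def
proof
  fix e
  assume "e \<in> Poly_Mapping.keys (p * q)"
  then obtain a c where "e = a + c" "a \<in> Poly_Mapping.keys p" "c \<in> Poly_Mapping.keys q"
    by (rule keys_multE)
  then show "Poly_Mapping.lookup e y = 0"
    using assms by (simp add: y_free_def lookup_add)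
qed

lemma y_free_prod:
  assumes "\<And>x. x \<in> X \<Longrightarrow> y_free y (f x)"
  shows "y_free y (\<Prod>x\<in>X. f x)"
  using assms
proof (induction X rule: infinite_finite_induct)
  case (insert x X)
  then show ?case by (simp add: y_free_mult)
qed (simp_all add: y_free_def)

text \<open>In the difference \<open>p - p' = p x\<^sup>m\<^sup>' - p' x\<^sup>m\<close> the left side has degree 0 in \<open>y\<close>, the right side degree 1.\<close>

lemma y_linear_factor_unique:
  fixes p p' :: "'k::field_char_0 fpoly"
  assumes free: "y_free y p" "y_free y p'" and "p \<noteq> 0"
    and m: "Poly_Mapping.lookup m y = 1" "Poly_Mapping.lookup m' y = 1"
    and eq: "p * (1 - fmonom m') = p' * (1 - fmonom m)"
  shows "m = m'"
proof -
  have diff: "p - p' = p * fmonom m' - p' * fmonom m"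
    using eq by (simp add: algebra_simps)
  have "p - p' = 0"
  proof (rule ccontr)
    assume "p - p' \<noteq> 0"
    then obtain e where e: "e \<in> Poly_Mapping.keys (p - p')"
      by (metis poly_mapping_eqI in_keys_iff lookup_zero)
    then have 0: "Poly_Mapping.lookup e y = 0"
      using keys_minus_subset[of p p'] free by (auto simp: y_free_def)
    have deg1: "Poly_Mapping.lookup d y = 1"
      if d: "d \<in> Poly_Mapping.keys (f * fmonom w)" and "y_free y f" "Poly_Mapping.lookup w y = 1"
      for d w and f :: "'k fpoly"
    proof -
      obtain a c where "d = a + c" "a \<in> Poly_Mapping.keys f"
        "c \<in> Poly_Mapping.keys (fmonom w :: 'k fpoly)"
        using d by (rule keys_multE)
      then show ?thesis using that by (simp add: y_free_def lookup_add)
    qed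
    have "e \<in> Poly_Mapping.keys (p * fmonom m') \<union> Poly_Mapping.keys (p' * fmonom m)"
      using e keys_minus_subset[of "p * fmonom m'" "p' * fmonom m"] by (auto simp: diff)
    then have "Poly_Mapping.lookup e y = 1"
      using deg1[OF _ free(1) m(2)] deg1[OF _ free(2) m(1)] by blast
    with 0 show False by simp
  qed
  \<comment> \<open>The degree 1 side vanishes as well, now with \<open>p = p'\<close>.\<close>
  with diff have "p * fmonom m' = p * fmonom m" by simp
  with \<open>p \<noteq> 0\<close> show ?thesis by simp
qed

text \<open>Isolating the distinguished factor leaves \<open>L\<close> and \<open>G\<close> of
  degree 0 in \<open>y\<close>, the shape that \<open>y_linear_factor_unique\<close> compares. The
  first equation is the argument of the substitution in CT.\<close>

lemma ct_form_factor_eqs: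
  fixes E :: "'k::field_char_0 frat"
  assumes E: "ct_form v y E S L u b j" and "E \<noteq> 0"
  defines "G \<equiv> \<Prod>l\<in>S - {j}. ct_factor v (u l) (b l)"
  shows "E * fpoly_frat (ct_factor v (u j) (b j)) = Fraction_Field.Fract L G"
    and "E = Fraction_Field.Fract L (G * ct_factor v (u j) (b j))"
    and "L \<noteq> 0" "G \<noteq> 0" "(ct_factor v (u j) (b j) :: 'k fpoly) \<noteq> 0"
    and "v \<noteq> y" "y_free y L" "y_free y G"
proof -
  let ?c = "ct_factor v (u j) (b j) :: 'k fpoly"
  have S: "finite S" "j \<in> S"
    and E_eq: "E = fpoly_frat L / (\<Prod>l\<in>S. fpoly_frat (ct_factor v (u l) (b l)))"
    and nz: "\<forall>l\<in>S. (ct_factor v (u l) (b l) :: 'k fpoly) \<noteq> 0"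
    and v: "\<forall>l\<in>S. v \<notin> Poly_Mapping.keys (u l)"
    and uj: "Poly_Mapping.lookup (u j) y = 1"
    and y: "\<forall>l\<in>S - {j}. y \<notin> Poly_Mapping.keys (u l)"
      "\<forall>e\<in>Poly_Mapping.keys L. y \<notin> Poly_Mapping.keys e"
    using E unfolding ct_form_def by simp_all
  have "(\<Prod>l\<in>S. ct_factor v (u l) (b l)) = G * ?c"
    using S by (simp add: G_def prod.remove mult.commute)
  then show E': "E = Fraction_Field.Fract L (G * ?c)"
    using E_eq by (simp add: fpoly_frat_prod[symmetric] fpoly_frat_divide)
  show c: "?c \<noteq> 0" using nz S(2) by (rule bspec)
  show "G \<noteq> 0" using nz S(1) by (simp add: G_def)
  show "L \<noteq> 0" using E_eq \<open>E \<noteq> 0\<close> by auto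
  show "E * fpoly_frat ?c = Fraction_Field.Fract L G"
    using c \<open>G \<noteq> 0\<close> by (simp add: E' fpoly_frat_def eq_fract mult.assoc)
  \<comment> \<open>\<open>u j\<close> contains \<open>y\<close> but not \<open>v\<close>. Hence the
    powers of \<open>v\<close> in the other factors contribute nothing to the degree in
    \<open>y\<close>.\<close>
  show "v \<noteq> y" using uj v S(2) by (auto simp: in_keys_iff)
  show "y_free y L" using y(2) by (simp add: y_free_def in_keys_iff)
  show "y_free y G" unfolding G_def
  proof (rule y_free_prod)
    fix l assume l: "l \<in> S - {j}"
    then have "Poly_Mapping.lookup (u l) y = 0" using y(1) by (auto simp: in_keys_iff)
    then show "y_free y (ct_factor v (u l) (b l))"
      unfolding y_free_def ct_factor_def
      using keys_fmonom_binomial \<open>v \<noteq> y\<close> by (force simp: lookup_add lookup_single when_def)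
  qed
qed

text \<open>Cross-multiplying the two representations gives an identity between the two
  distinguished factors with multipliers of degree 0 in \<open>y\<close>; these are nonzero because
  \<open>E\<close> is.\<close>

lemma ct_form_factor_unique:
  fixes E :: "'k::field_char_0 frat"
  assumes E: "ct_form v y E S L u b j" and E': "ct_form v y E S' L' u' b' j'" and nz: "E \<noteq> 0"
  shows "u j = u' j'" "b j = b' j'"
proof -
  let ?m = "u j + Poly_Mapping.single v (b j)" and ?m' = "u' j' + Poly_Mapping.single v (b' j')"
  let ?G = "\<Prod>l\<in>S - {j}. ct_factor v (u l) (b l) :: 'k fpoly"
  let ?G' = "\<Prod>l\<in>S' - {j'}. ct_factor v (u' l) (b' l) :: 'k fpoly"
  note f = ct_form_factor_eqs[OF E nz] and f' = ct_form_factor_eqs[OF E' nz]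
  have uj: "Poly_Mapping.lookup (u j) y = 1" "Poly_Mapping.lookup (u j) v = 0"
    "Poly_Mapping.lookup (u' j') y = 1" "Poly_Mapping.lookup (u' j') v = 0"
    using E E' unfolding ct_form_def by (auto simp: in_keys_iff)
  have "Fraction_Field.Fract L (?G * ct_factor v (u j) (b j)) =
      Fraction_Field.Fract L' (?G' * ct_factor v (u' j') (b' j'))"
    using f(2) f'(2) by (rule subst)
  moreover have "?G * ct_factor v (u j) (b j) \<noteq> 0" "?G' * ct_factor v (u' j') (b' j') \<noteq> 0"
    using f(4,5) f'(4,5) by (simp_all only: mult_eq_0_iff simp_thms)
  ultimately have "L * (?G' * ct_factor v (u' j') (b' j')) = L' * (?G * ct_factor v (u j) (b j))"
    using eq_fract(1) by blast
  then have "(L * ?G') * (1 - fmonom ?m') = (L' * ?G) * (1 - fmonom ?m)"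
    by (simp add: ct_factor_def mult.assoc)
  then have "?m = ?m'"
    using f f' uj
    by (intro y_linear_factor_unique[of y "L * ?G'" "L' * ?G"])
      (auto simp: lookup_add lookup_single when_def intro: y_free_mult)
  \<comment> \<open>Neither \<open>u j\<close> nor \<open>u' j'\<close> contains \<open>v\<close>,
    so coordinate \<open>v\<close> of the common exponent recovers the power of \<lambda>.\<close>
  moreover from this have "Poly_Mapping.lookup ?m v = Poly_Mapping.lookup ?m' v" by simp
  then show "b j = b' j'" using uj by (simp add: lookup_add)
  ultimately show "u j = u' j'" by simp
qed

text \<open>For fixed \<open>E\<close>, the value depends on the chosen representation only through
  \<open>u j\<close> and \<open>b j\<close>, which are unique.\<close>

lemma ct_op_eq:
  assumes E: "ct_form v y E S L u b j" and nz: "E \<noteq> 0"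
  shows "ct_op v y E = fconst (of_rat (sgn (b j))) *
    Z_op y (subst_frat v (scale_expo (- (1 / b j)) (u j)) (E * fpoly_frat (ct_factor v (u j) (b j))))"
  unfolding ct_op_def
proof (rule the_equality, goal_cases)
  case 1
  show ?case using E by blast
next
  case (2 F)
  then show ?case using ct_form_factor_unique[OF E _ nz] by metis
qed

section \<open>Pivot steps\<close>

lemma pivoted_dim:
  assumes "pivoted n r M k I J Q"
  shows "dim_row Q = dim_row M" "dim_col Q = dim_col M"
  using assms by (induction rule: pivoted.induct) (simp_all add: pivot_op_def)

text \<open>A pivot in column \<open>j\<close> adds multiples of that column to the others. A row
  \<open>a\<close> outside the new \<open>J\<close> has \<open>a\<close> distinct from
  \<open>j\<close>, hence entry 0 in column \<open>j\<close>, and stays unchanged.\<close>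

lemma pivoted_identity_rows:
  assumes "pivoted n r M k I J Q" and "n \<le> dim_row M" "dim_col M = Suc n"
    and "\<And>a s. a < n \<Longrightarrow> s \<le> n \<Longrightarrow> M $$ (a, s) = (if a = s then 1 else 0)"
    and "a < n" "a \<notin> J" "s \<le> n"
  shows "Q $$ (a, s) = (if a = s then 1 else 0)"
  using assms
proof (induction arbitrary: a s rule: pivoted.induct)
  case (step k I J Q i j)
  then have "a < dim_row Q" "s < dim_col Q" by (simp_all add: pivoted_dim)
  with step show ?case by (auto simp: pivot_op_def)
qed simp

lemma init_mat_identity_rows:
  assumes "A \<in> carrier_mat r n"
  shows "dim_row (init_mat n r A b) = n + r" "dim_col (init_mat n r A b) = Suc n"
    and "a < n \<Longrightarrow> s \<le> n \<Longrightarrow> init_mat n r A b $$ (a, s) = (if a = s then 1 else 0)"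
  using assms by (auto simp: init_mat_def)

lemma lookup_col_expo:
  "Poly_Mapping.lookup (col_expo n I Q s) a =
    (if a < dim_row Q \<and> a \<notin> (\<lambda>i. n + i) ` I then Q $$ (a, s) else 0)"
  by (simp add: col_expo_def lookup_sum lookup_single when_def)

text \<open>The pivot row is omitted on the right; on the left it is eliminated by the substitution.\<close>

lemma subst_expo_col_expo:
  assumes "n + i < dim_row Q" "i \<notin> I" "s < dim_col Q" "s \<noteq> j"
  defines "\<gamma> \<equiv> col_expo n I Q j - Poly_Mapping.single (n + i) (Q $$ (n + i, j))"
  shows "subst_expo (n + i) (scale_expo (- (1 / Q $$ (n + i, j))) \<gamma>) (col_expo n I Q s) =
    col_expo n (insert i I) (pivot_op n Q i j) s"
  by (rule poly_mapping_eqI)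
    (use assms in \<open>auto simp: lookup_subst_expo lookup_col_expo lookup_minus lookup_single when_def
      pivot_op_def\<close>)

lemma bracket_Fract:
  "bracket n I J Q = (Fraction_Field.Fract (fmonom (col_expo n I Q n))
     (\<Prod>s\<in>{..<n} - J. 1 - fmonom (col_expo n I Q s)) :: 'k::field_char_0 frat)"
proof -
  have "bracket n I J Q = fpoly_frat (fmonom (col_expo n I Q n)) /
      (fpoly_frat (\<Prod>s\<in>{..<n} - J. 1 - fmonom (col_expo n I Q s)) :: 'k frat)"
    by (simp add: bracket_def fpoly_frat_prod fpoly_frat_minus)
  then show ?thesis by (simp only: fpoly_frat_divide)
qed

text \<open>Here \<open>u s\<close> is column \<open>s\<close> without its \<lambda> entry. The
  numerator comes from column \<open>n\<close>, which is 0 in every identity row, so it is free of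
  the variable \<open>j\<close>.\<close>

lemma ct_form_bracket:
  fixes Q :: "rat mat"
  assumes dim: "n + i < dim_row Q" and i: "i \<notin> I" and j: "j \<in> {..<n} - J"
    and pivot: "Q $$ (n + i, j) \<noteq> 0"
    and id: "\<And>a s. a < n \<Longrightarrow> a \<notin> J \<Longrightarrow> s \<le> n \<Longrightarrow> Q $$ (a, s) = (if a = s then 1 else 0)"
  defines "u \<equiv> \<lambda>s. col_expo n I Q s - Poly_Mapping.single (n + i) (Q $$ (n + i, s))"
  shows "ct_form (n + i) j (bracket n I J Q :: 'k::field_char_0 frat) ({..<n} - J)
    (fmonom (col_expo n I Q n)) u (\<lambda>s. Q $$ (n + i, s)) j"
proof -
  have factor: "(ct_factor (n + i) (u s) (Q $$ (n + i, s)) :: 'k fpoly) = 1 - fmonom (col_expo n I Q s)" for s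
    by (simp add: ct_factor_def u_def)
  have col: "Poly_Mapping.lookup (col_expo n I Q s) a = (if a = s then 1 else 0)"
    if "a \<in> {..<n} - J" "s \<le> n" for a s
    using that dim id by (auto simp: lookup_col_expo)
  have u: "Poly_Mapping.lookup (u s) a = (if a = s then 1 else 0)" if "a \<in> {..<n} - J" "s \<le> n" for a s
    using that col by (auto simp: u_def lookup_minus lookup_single when_def)
  \<comment> \<open>Row \<open>n + i\<close> is not ignored, so the subtracted entry is exactly the
    one occurring in the column exponent.\<close>
  have v: "Poly_Mapping.lookup (u s) (n + i) = 0" for s
    using i dim by (auto simp: u_def lookup_minus lookup_col_expo)
  have nz: "col_expo n I Q s \<noteq> 0" if "s \<in> {..<n} - J" for s
    using that col[of s s] by auto
  have "coprime_fpoly (1 - fmonom (col_expo n I Q s) :: 'k fpoly) (1 - fmonom (col_expo n I Q t))"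
    if "s \<in> {..<n} - J" "t \<in> {..<n} - J" "s \<noteq> t" for s t
    using that by (intro coprime_fmonom_binomial[of _ s t]) (simp_all add: col)
  then show ?thesis
    unfolding ct_form_def factor using j pivot u v nz
    by (auto simp: in_keys_iff col bracket_def fpoly_frat_minus)
qed

text \<open>With the factor of column \<open>j\<close> cancelled, the substitution acts on each
  remaining column, including the numerator column \<open>n\<close>, by
  \<open>subst_expo_col_expo\<close>.\<close>

lemma subst_bracket:
  fixes Q :: "rat mat"
  assumes dim: "n + i < dim_row Q" "dim_col Q = Suc n" and i: "i \<notin> I" and j: "j \<in> {..<n} - J"
    and id: "\<And>a s. a < n \<Longrightarrow> a \<notin> J \<Longrightarrow> s \<le> n \<Longrightarrow> Q $$ (a, s) = (if a = s then 1 else 0)"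
  defines "\<gamma> \<equiv> col_expo n I Q j - Poly_Mapping.single (n + i) (Q $$ (n + i, j))"
  shows "subst_frat (n + i) (scale_expo (- (1 / Q $$ (n + i, j))) \<gamma>)
      (Fraction_Field.Fract (fmonom (col_expo n I Q n))
        (\<Prod>s\<in>{..<n} - J - {j}. 1 - fmonom (col_expo n I Q s))) =
    (bracket n (insert i I) (insert j J) (pivot_op n Q i j) :: 'k::field_char_0 frat)"
proof -
  let ?R = "pivot_op n Q i j"
  let ?\<sigma> = "subst_fpoly (n + i) (scale_expo (- (1 / Q $$ (n + i, j))) \<gamma>) :: 'k fpoly \<Rightarrow> _"
  have subst: "?\<sigma> (fmonom (col_expo n I Q s)) = fmonom (col_expo n (insert i I) ?R s)"
    if "s \<le> n" "s \<noteq> j" for s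
    using that dim i by (simp add: \<gamma>_def subst_expo_col_expo)
  have prod: "?\<sigma> (\<Prod>s\<in>{..<n} - J - {j}. 1 - fmonom (col_expo n I Q s)) =
      (\<Prod>s\<in>{..<n} - insert j J. 1 - fmonom (col_expo n (insert i I) ?R s))"
    unfolding subst_fpoly_prod
    by (rule prod.cong) (auto simp: subst_fpoly_minus subst simp del: subst_fpoly_fmonom)
  have "col_expo n (insert i I) ?R s \<noteq> 0" if s: "s \<in> {..<n} - insert j J" for s
  proof -
    \<comment> \<open>Row \<open>s\<close> is 0 in column \<open>j\<close>, so its diagonal 1
      survives the pivot; this keeps the substituted denominator nonzero.\<close>
    have "?R $$ (s, s) = 1" using s j dim id by (auto simp: pivot_op_def)
    then have "Poly_Mapping.lookup (col_expo n (insert i I) ?R s) s = 1"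
      using s dim by (auto simp: lookup_col_expo pivot_op_def)
    then show ?thesis by auto
  qed
  then have "(\<Prod>s\<in>{..<n} - insert j J. 1 - fmonom (col_expo n (insert i I) ?R s)) \<noteq> (0 :: 'k fpoly)"
    by auto
  then show ?thesis
    using j by (subst subst_frat_Fract) (simp_all add: prod subst bracket_Fract del: subst_fpoly_fmonom)
qed

theorem theorem12:
  fixes A :: "int mat" and b :: "int vec" and Q :: "rat mat"
    and n r k i j :: nat and I J :: "nat set"
  assumes "A \<in> carrier_mat r n" and "b \<in> carrier_vec r"
    and "I \<subseteq> {..<r}" and "J \<subseteq> {..<n}" and "card I = k" and "card J = k"
    and "pivoted n r (init_mat n r A b) k I J Q"
    and "i \<in> {..<r} - I" and "j \<in> {..<n} - J"
    and "Q $$ (n + i, j) \<noteq> 0"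
  shows "ct_op (n + i) j (bracket n I J Q) =
         fconst (of_rat (sgn (Q $$ (n + i, j)))) *
           Z_op j (bracket n (insert i I) (insert j J) (pivot_op n Q i j)
                   :: 'k::field_char_0 frat)"
proof -
  let ?E = "bracket n I J Q :: 'k frat"
  note M = init_mat_identity_rows[OF assms(1), where b = b]
  have dim: "dim_row Q = n + r" "dim_col Q = Suc n"
    using pivoted_dim[OF assms(7)] M(1,2) by simp_all
  have id: "Q $$ (a, s) = (if a = s then 1 else 0)" if "a < n" "a \<notin> J" "s \<le> n" for a s
    using pivoted_identity_rows[OF assms(7) _ M(2,3)] that M(1) by simp
  have row: "n + i < dim_row Q" and i: "i \<notin> I" using dim assms(8) by auto
  note form = ct_form_bracket[OF row i assms(9,10) id, where 'k = 'k]
  \<comment> \<open>The numerator is a monomial, but division by 0 yields 0, so the denominator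
    factors must be shown nonzero; \<open>form\<close> supplies this.\<close>
  have "?E \<noteq> 0"
  proof -
    have "\<forall>s\<in>{..<n} - J. fpoly_frat (ct_factor (n + i)
        (col_expo n I Q s - Poly_Mapping.single (n + i) (Q $$ (n + i, s))) (Q $$ (n + i, s))) \<noteq> (0 :: 'k frat)"
      using form by (simp add: ct_form_def)
    then have "\<forall>s\<in>{..<n} - J. 1 - fpoly_frat (fmonom (col_expo n I Q s)) \<noteq> (0 :: 'k frat)"
      by (simp add: ct_factor_def fpoly_frat_minus)
    then show ?thesis by (simp add: bracket_def)
  qed
  then show ?thesis
    \<comment> \<open>The role of \<open>b j\<close> is played by the pivot item, which supplies the
      sign. Multiplying by the distinguished factor leaves the fraction treated in
      \<open>subst_bracket\<close>.\<close>
    using ct_op_eq[OF form] ct_form_factor_eqs(1)[OF form]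
      subst_bracket[OF row dim(2) i assms(9) id, where 'k = 'k]
    by (simp add: ct_factor_def)
qed

end
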